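(* Let $\mathcal{A}$ be an independence algebra with universe $A$ and let $\mathcal{B}$ be a non-empty subalgebra of $\mathcal{A}$ with universe $B$. Assume $\mathcal{B}\neq\mathcal{A}$ and that either $\dim B\geq 2$, or $\langle\emptyset\rangle\neq\emptyset$ and $\dim B=1$. Let $T(\mathcal{A},\mathcal{B})$ be the semigroup of all endomorphisms of $\mathcal{A}$ whose image is contained in $B$. Let $e=0$ if $\langle\emptyset\rangle\neq\emptyset$ and $e=1$ otherwise, and let $T_{e^+}=\{\alpha\in T(\mathcal{A},\mathcal{B}):\rho(\alpha)<e+1\}$ (that is, the set of maps of rank $e$). Then in $T(\mathcal{A},\mathcal{B})$ the only $\widetilde{\mathcal{D}}$-classes are $T_{e^+}$ and its complement $T(\mathcal{A},\mathcal{B})\setminus T_{e^+}$, and likewise the only $\widetilde{\mathcal{J}}$-classes are $T_{e^+}$ and $T(\mathcal{A},\mathcal{B})\setminus T_{e^+}$.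
   Context: An algebra $\mathcal{A}=\langle A;F\rangle$ has a non-empty universe $A$ and a set $F$ of finitary operations. For $X\subseteq A$, $\langle X\rangle$ is the set of all $t(a_1,\dots,a_n)$ with $t$ a term operation and $a_i\in X$ (the subalgebra generated by $X$); $\langle\emptyset\rangle$ is the set of constants, i.e. values of nullary term operations (possibly empty). $X$ is independent if $x\notin\langle X\setminus\{x\}\rangle$ for all $x\in X$; a basis of a subalgebra is an independent generating set. Exchange property (EP): for all $X\subseteq A$ and $a,b\in A$, if $b\in\langle X\cup\{a\}\rangle$ and $b\notin\langle X\rangle$ then $a\in\langle X\cup\{b\}\rangle$. Under (EP) every subalgebra has a basis, all its bases have the same cardinality (its dimension, $\dim$), and independent sets extend to bases. Free basis property (F): every map from a basis of $\mathcal{A}$ to $A$ extends to an endomorphism of $\mathcal{A}$. An independence algebra is an algebra satisfying (EP) and (F). Dimensions may be finite or infinite. Maps are written on the right and composed left to right. $\rho(\alpha)=\dim(A\alpha)$. For a semigroup $S$ with set of idempotents $E(S)$ and $a,b\in S$: $a\,\widetilde{\mathcal{L}}\,b$ iff for all $f\in E(S)$, $af=a\Leftrightarrow bf=b$; $a\,\widetilde{\mathcal{R}}\,b$ iff for all $f\in E(S)$, $fa=a\Leftrightarrow fb=b$. $\widetilde{\mathcal{D}}=\widetilde{\mathcal{L}}\vee\widetilde{\mathcal{R}}$ is the smallest equivalence relation containing both. $\widetilde{J}(a)$ is the smallest (two-sided) ideal of $S$ that contains $a$ and is saturated by $\widetilde{\mathcal{L}}$ and $\widetilde{\mathcal{R}}$,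 i.e. is a union of $\widetilde{\mathcal{L}}$-classes and also a union of $\widetilde{\mathcal{R}}$-classes; and $a\,\widetilde{\mathcal{J}}\,b$ iff $\widetilde{J}(a)=\widetilde{J}(b)$. *)

theory Defs
  imports Main "HOL-Library.FuncSet"
begin

unbundle cardinal_syntax

text \<open>
  A finitary operation is a pair of its arity \<open>n\<close> and a function on argument lists;
  only the values at lists of length \<open>n\<close> over the universe matter.
\<close>

record 'a alg =
  Univ :: "'a set"
  Ops :: "(nat \<times> ('a list \<Rightarrow> 'a)) set"

definition is_alg :: "'a alg \<Rightarrow> bool" where
  "is_alg \<A> \<longleftrightarrow> Univ \<A> \<noteq> {} \<and>
    (\<forall>(n, f) \<in> Ops \<A>. \<forall>xs. length xs = n \<and> set xs \<subseteq> Univ \<A> \<longrightarrow> f xs \<in> Univ \<A>)"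

inductive_set term_ops :: "'a alg \<Rightarrow> nat \<Rightarrow> ('a list \<Rightarrow> 'a) set"
  for \<A> :: "'a alg" and n :: nat where
  proj: "i < n \<Longrightarrow> (\<lambda>xs. xs ! i) \<in> term_ops \<A> n"
| comp: "(k, f) \<in> Ops \<A> \<Longrightarrow> length ts = k \<Longrightarrow> \<forall>t \<in> set ts. t \<in> term_ops \<A> n \<Longrightarrow>
    (\<lambda>xs. f (map (\<lambda>t. t xs) ts)) \<in> term_ops \<A> n"

text \<open>For \<open>X = {}\<close> only nullary term operations contribute.\<close>

definition sub_gen :: "'a alg \<Rightarrow> 'a set \<Rightarrow> 'a set" where
  "sub_gen \<A> X = {t xs |n t xs. t \<in> term_ops \<A> n \<and> length xs = n \<and> set xs \<subseteq> X}"

definition subalg :: "'a set \<Rightarrow> 'a alg \<Rightarrow> bool" where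
  "subalg B \<A> \<longleftrightarrow> B \<subseteq> Univ \<A> \<and>
    (\<forall>(n, f) \<in> Ops \<A>. \<forall>xs. length xs = n \<and> set xs \<subseteq> B \<longrightarrow> f xs \<in> B)"

definition alg_indep :: "'a alg \<Rightarrow> 'a set \<Rightarrow> bool" where
  "alg_indep \<A> X \<longleftrightarrow> (\<forall>x \<in> X. x \<notin> sub_gen \<A> (X - {x}))"

definition alg_basis :: "'a alg \<Rightarrow> 'a set \<Rightarrow> 'a set \<Rightarrow> bool" where
  "alg_basis \<A> B X \<longleftrightarrow> X \<subseteq> B \<and> alg_indep \<A> X \<and> sub_gen \<A> X = B"

text \<open>
  Dimensions are cardinals, represented up to \<open>=o\<close>.  The choice of the basis is
  irrelevant for subalgebras of algebras with the exchange property.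
\<close>

definition alg_dim :: "'a alg \<Rightarrow> 'a set \<Rightarrow> 'a rel" where
  "alg_dim \<A> B = |SOME X. alg_basis \<A> B X|"

definition exchange_property :: "'a alg \<Rightarrow> bool" where
  "exchange_property \<A> \<longleftrightarrow> (\<forall>X. X \<subseteq> Univ \<A> \<longrightarrow> (\<forall>a \<in> Univ \<A>. \<forall>b \<in> Univ \<A>.
    b \<in> sub_gen \<A> (X \<union> {a}) \<and> b \<notin> sub_gen \<A> X \<longrightarrow> a \<in> sub_gen \<A> (X \<union> {b})))"

text \<open>Endomorphisms are extensional, so that equality of maps on the universe is equality.\<close>

definition alg_endos :: "'a alg \<Rightarrow> ('a \<Rightarrow> 'a) set" where
  "alg_endos \<A> = {h \<in> Univ \<A> \<rightarrow>\<^sub>E Univ \<A>.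
    \<forall>(n, f) \<in> Ops \<A>. \<forall>xs. length xs = n \<and> set xs \<subseteq> Univ \<A> \<longrightarrow> h (f xs) = f (map h xs)}"

definition free_basis_property :: "'a alg \<Rightarrow> bool" where
  "free_basis_property \<A> \<longleftrightarrow> (\<forall>X. alg_basis \<A> (Univ \<A>) X \<longrightarrow>
    (\<forall>\<phi> \<in> X \<rightarrow> Univ \<A>. \<exists>h \<in> alg_endos \<A>. \<forall>x \<in> X. h x = \<phi> x))"

definition independence_algebra :: "'a alg \<Rightarrow> bool" where
  "independence_algebra \<A> \<longleftrightarrow> is_alg \<A> \<and> exchange_property \<A> \<and> free_basis_property \<A>"

definition endos_into :: "'a alg \<Rightarrow> 'a set \<Rightarrow> ('a \<Rightarrow> 'a) set" where
  "endos_into \<A> B = {\<alpha> \<in> alg_endos \<A>. \<alpha> ` Univ \<A> \<subseteq> B}"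

text \<open>Maps are composed from left to right: \<open>\<alpha>\<close> is applied first.\<close>

definition endo_mult :: "'a alg \<Rightarrow> ('a \<Rightarrow> 'a) \<Rightarrow> ('a \<Rightarrow> 'a) \<Rightarrow> ('a \<Rightarrow> 'a)" where
  "endo_mult \<A> \<alpha> \<beta> = compose (Univ \<A>) \<beta> \<alpha>"

definition endo_rank :: "'a alg \<Rightarrow> ('a \<Rightarrow> 'a) \<Rightarrow> 'a rel" where
  "endo_rank \<A> \<alpha> = alg_dim \<A> (\<alpha> ` Univ \<A>)"

text \<open>Below, a semigroup is given by its set of elements \<open>S\<close> and its multiplication \<open>m\<close>.\<close>

definition sg_idems :: "'s set \<Rightarrow> ('s \<Rightarrow> 's \<Rightarrow> 's) \<Rightarrow> 's set" where
  "sg_idems S m = {f \<in> S. m f f = f}"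

definition L_tilde :: "'s set \<Rightarrow> ('s \<Rightarrow> 's \<Rightarrow> 's) \<Rightarrow> 's rel" where
  "L_tilde S m = {(a, b) \<in> S \<times> S. \<forall>f \<in> sg_idems S m. m a f = a \<longleftrightarrow> m b f = b}"

definition R_tilde :: "'s set \<Rightarrow> ('s \<Rightarrow> 's \<Rightarrow> 's) \<Rightarrow> 's rel" where
  "R_tilde S m = {(a, b) \<in> S \<times> S. \<forall>f \<in> sg_idems S m. m f a = a \<longleftrightarrow> m f b = b}"

definition D_tilde :: "'s set \<Rightarrow> ('s \<Rightarrow> 's \<Rightarrow> 's) \<Rightarrow> 's rel" where
  "D_tilde S m = \<Inter> {r. equiv S r \<and> L_tilde S m \<subseteq> r \<and> R_tilde S m \<subseteq> r}"

definition sg_ideal :: "'s set \<Rightarrow> ('s \<Rightarrow> 's \<Rightarrow> 's) \<Rightarrow> 's set \<Rightarrow> bool" where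
  "sg_ideal S m I \<longleftrightarrow> I \<noteq> {} \<and> I \<subseteq> S \<and> (\<forall>a \<in> I. \<forall>s \<in> S. m s a \<in> I \<and> m a s \<in> I)"

definition saturated_by :: "'s set \<Rightarrow> 's rel \<Rightarrow> 's set \<Rightarrow> bool" where
  "saturated_by S r I \<longleftrightarrow> (\<exists>C \<subseteq> S // r. I = \<Union> C)"

definition J_tilde_ideal :: "'s set \<Rightarrow> ('s \<Rightarrow> 's \<Rightarrow> 's) \<Rightarrow> 's \<Rightarrow> 's set" where
  "J_tilde_ideal S m a = \<Inter> {I. sg_ideal S m I \<and> a \<in> I \<and>
    saturated_by S (L_tilde S m) I \<and> saturated_by S (R_tilde S m) I}"

definition J_tilde :: "'s set \<Rightarrow> ('s \<Rightarrow> 's \<Rightarrow> 's) \<Rightarrow> 's rel" where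
  "J_tilde S m = {(a, b) \<in> S \<times> S. J_tilde_ideal S m a = J_tilde_ideal S m b}"

end

theory Submission
  imports Defs
begin

text \<open>
  In \<open>T(\<A>, B)\<close> every non-empty subalgebra of \<open>B\<close> is the image of an idempotent, so
  \<open>\<alpha>\<close> and \<open>\<beta>\<close> are L-tilde-related iff they have the same image.  An idempotent \<open>f\<close> with
  \<open>f \<alpha> = \<alpha>\<close> forces \<open>B \<alpha> = A \<alpha>\<close>; hence all \<open>\<alpha>\<close> with \<open>B \<alpha> \<noteq> A \<alpha>\<close> lie in one
  R-tilde-class.  As \<open>B \<noteq> A\<close>, every subalgebra of \<open>B\<close> of dimension greater than \<open>e\<close> is the image
  of such a map: a basis element outside \<open>B\<close> hits a basis element that \<open>B\<close> misses.  So
  the maps of rank greater than \<open>e\<close> are all D-tilde-related.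

  The maps of rank \<open>e\<close> are those whose image is a minimal non-empty subalgebra.  Any two minimal
  non-empty subalgebras are equal or isomorphic through endomorphisms, so these maps are
  D-tilde-related too, and each of them is fixed from the left by an idempotent of rank
  \<open>e\<close>, which no map of higher rank is.  Saturated ideals are unions of D-tilde-classes,
  and every ideal meets the ideal of maps of rank \<open>e\<close>; so only that ideal and the whole
  semigroup are saturated.
\<close>

section \<open>Comparison with finite cardinals\<close>

lemma finite_card_of_ordIso_iff:
  assumes "finite B"
  shows "|A| =o |B| \<longleftrightarrow> finite A \<and> card A = card B"
  using assms card_of_ordIso[of A B] card_of_ordIso_finite[of A B] bij_betw_iff_card[of A B]
  by blast

lemma finite_card_of_ordLess_iff:
  assumes "finite B"
  shows "|A| <o |B| \<longleftrightarrow> finite A \<and> card A < card B"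
proof (cases "finite A")
  case True
  have "|B| \<le>o |A| \<longleftrightarrow> card B \<le> card A"
    using card_of_ordLeq[of B A] inj_on_iff_card_le[OF assms True] by blast
  then show ?thesis using True not_ordLeq_iff_ordLess[OF card_of_Well_order card_of_Well_order, of B A]
    by auto
next
  case False
  then show ?thesis using assms card_of_ordLeq_finite ordLess_imp_ordLeq by blast
qed


section \<open>Generated subalgebras\<close>

text \<open>The generated subalgebra again, as an induction on elements: closure proofs then need no
  term operations, and \<open>sub_gen_eq_op_closure\<close> carries them back to
  \<open>sub_gen\<close>.\<close>

inductive_set op_closure :: "'a alg \<Rightarrow> 'a set \<Rightarrow> 'a set" for \<A> X where
  base: "x \<in> X \<Longrightarrow> x \<in> op_closure \<A> X"
| step: "(k, f) \<in> Ops \<A> \<Longrightarrow> length xs = k \<Longrightarrow> \<forall>x \<in> set xs. x \<in> op_closure \<A> X \<Longrightarrow>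
    f xs \<in> op_closure \<A> X"

lemma op_closure_mono: "v \<in> op_closure \<A> X \<Longrightarrow> X \<subseteq> Y \<Longrightarrow> v \<in> op_closure \<A> Y"
  by (induction rule: op_closure.induct) (auto intro: op_closure.intros)

text \<open>A derivation uses finitely many generators. They are collected in a list, by
  concatenating the lists for the arguments of an operation, because a term operation takes a
  list.\<close>

lemma op_closure_finitary:
  "v \<in> op_closure \<A> X \<Longrightarrow> \<exists>xs. set xs \<subseteq> X \<and> v \<in> op_closure \<A> (set xs)"
proof (induction rule: op_closure.induct)
  case (base x)
  then show ?case by (intro exI[of _ "[x]"]) (auto intro: op_closure.base)
next
  case (step k f vs)
  then obtain g where g: "\<forall>v \<in> set vs. set (g v) \<subseteq> X \<and> v \<in> op_closure \<A> (set (g v))"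
    by metis
  have "set (g v) \<subseteq> set (concat (map g vs))" if "v \<in> set vs" for v
    using that by auto
  then have "\<forall>v \<in> set vs. v \<in> op_closure \<A> (set (concat (map g vs)))"
    using g op_closure_mono by metis
  then have "f vs \<in> op_closure \<A> (set (concat (map g vs)))"
    using step.hyps by (intro op_closure.step) auto
  moreover have "set (concat (map g vs)) \<subseteq> X" using g by auto
  ultimately show ?case by blast
qed

text \<open>The generators stay one fixed list during the induction, so the terms found for the
  arguments share one arity and can be composed.\<close>

lemma op_closure_set_term:
  "v \<in> op_closure \<A> (set xs) \<Longrightarrow> \<exists>t \<in> term_ops \<A> (length xs). t xs = v"
proof (induction rule: op_closure.induct)
  case (base x)
  then show ?case by (metis in_set_conv_nth term_ops.proj)
next
  case (step k f vs)
  then obtain g where g: "\<forall>v \<in> set vs. g v \<in> term_ops \<A> (length xs) \<and> g v xs = v"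
    by metis
  have "(\<lambda>xs. f (map (\<lambda>t. t xs) (map g vs))) \<in> term_ops \<A> (length xs)"
    using step.hyps g by (intro term_ops.comp) auto
  moreover have "map (\<lambda>t. t xs) (map g vs) = vs"
    using g by (auto intro: map_idI)
  ultimately show ?case by metis
qed

lemma term_in_op_closure:
  "t \<in> term_ops \<A> n \<Longrightarrow> length xs = n \<Longrightarrow> set xs \<subseteq> X \<Longrightarrow> t xs \<in> op_closure \<A> X"
proof (induction rule: term_ops.induct)
  case (proj i)
  then show ?case by (intro op_closure.base) (auto dest: nth_mem)
next
  case (comp k f ts)
  then show ?case by (intro op_closure.step[OF comp.hyps(1)]) auto
qed

lemma sub_gen_eq_op_closure: "sub_gen \<A> X = op_closure \<A> X"
proof
  show "sub_gen \<A> X \<subseteq> op_closure \<A> X"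
    unfolding sub_gen_def by (clarify, rule term_in_op_closure, auto)
  show "op_closure \<A> X \<subseteq> sub_gen \<A> X"
  proof
    fix v assume "v \<in> op_closure \<A> X"
    then obtain xs where xs: "set xs \<subseteq> X" "v \<in> op_closure \<A> (set xs)"
      using op_closure_finitary[of v \<A> X] by auto
    obtain t where "t \<in> term_ops \<A> (length xs)" "v = t xs"
      using op_closure_set_term[OF xs(2)] by auto
    then show "v \<in> sub_gen \<A> X"
      using xs(1) unfolding sub_gen_def
      by (intro CollectI exI[of _ "length xs"] exI[of _ t] exI[of _ xs]) simp
  qed
qed

lemma sub_gen_incr: "X \<subseteq> sub_gen \<A> X"
  by (auto simp: sub_gen_eq_op_closure intro: op_closure.base)

lemma sub_gen_mono: "X \<subseteq> Y \<Longrightarrow> sub_gen \<A> X \<subseteq> sub_gen \<A> Y"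
  by (auto simp: sub_gen_eq_op_closure intro: op_closure_mono)

lemma sub_gen_finitary:
  "v \<in> sub_gen \<A> X \<Longrightarrow> \<exists>F. finite F \<and> F \<subseteq> X \<and> v \<in> sub_gen \<A> F"
  unfolding sub_gen_eq_op_closure using op_closure_finitary[of v \<A> X] List.finite_set by metis

section \<open>Subalgebras and endomorphisms\<close>

lemma subalgD:
  "subalg C \<A> \<Longrightarrow> (n, f) \<in> Ops \<A> \<Longrightarrow> length xs = n \<Longrightarrow> set xs \<subseteq> C \<Longrightarrow> f xs \<in> C"
  by (auto simp: subalg_def)

lemma sub_gen_least:
  assumes "subalg C \<A>" "X \<subseteq> C"
  shows "sub_gen \<A> X \<subseteq> C"
proof
  fix v assume "v \<in> sub_gen \<A> X"
  then show "v \<in> C" unfolding sub_gen_eq_op_closure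
  proof (induction rule: op_closure.induct)
    case (base x)
    then show ?case using assms(2) by blast
  next
    case (step k f xs)
    then show ?case by (intro subalgD[OF assms(1) step.hyps(1,2)]) auto
  qed
qed

lemma sub_gen_subalg: "subalg C \<A> \<Longrightarrow> sub_gen \<A> C = C"
  by (simp add: sub_gen_incr sub_gen_least subset_antisym)

lemma alg_endosD:
  "h \<in> alg_endos \<A> \<Longrightarrow> (n, f) \<in> Ops \<A> \<Longrightarrow> length xs = n \<Longrightarrow> set xs \<subseteq> Univ \<A> \<Longrightarrow>
    h (f xs) = f (map h xs)"
  by (auto simp: alg_endos_def)

lemma alg_endos_in_Univ: "h \<in> alg_endos \<A> \<Longrightarrow> x \<in> Univ \<A> \<Longrightarrow> h x \<in> Univ \<A>"
  by (auto simp: alg_endos_def)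

lemma endo_mult_apply [simp]: "x \<in> Univ \<A> \<Longrightarrow> endo_mult \<A> \<alpha> \<beta> x = \<beta> (\<alpha> x)"
  by (simp add: endo_mult_def compose_def)

lemma endo_mult_in_endos:
  assumes \<alpha>: "\<alpha> \<in> alg_endos \<A>" and \<beta>: "\<beta> \<in> alg_endos \<A>" and "is_alg \<A>"
  shows "endo_mult \<A> \<alpha> \<beta> \<in> alg_endos \<A>"
proof -
  have "endo_mult \<A> \<alpha> \<beta> (f xs) = f (map (endo_mult \<A> \<alpha> \<beta>) xs)"
    if f: "(n, f) \<in> Ops \<A>" and xs: "length xs = n" "set xs \<subseteq> Univ \<A>" for n f xs
  proof -
    have fx: "f xs \<in> Univ \<A>" using assms(3) f xs by (auto simp: is_alg_def)
    have "set (map \<alpha> xs) \<subseteq> Univ \<A>" using xs alg_endos_in_Univ[OF \<alpha>] by auto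
    then have "\<beta> (\<alpha> (f xs)) = f (map \<beta> (map \<alpha> xs))"
      using alg_endosD[OF \<alpha> f xs] alg_endosD[OF \<beta> f, of "map \<alpha> xs"] xs by simp
    also have "map \<beta> (map \<alpha> xs) = map (endo_mult \<A> \<alpha> \<beta>) xs"
      using xs by auto
    finally show ?thesis using fx by simp
  qed
  moreover have "endo_mult \<A> \<alpha> \<beta> \<in> Univ \<A> \<rightarrow>\<^sub>E Univ \<A>"
    using alg_endos_in_Univ[OF \<alpha>] alg_endos_in_Univ[OF \<beta>]
    by (auto simp: endo_mult_def compose_def)
  ultimately show ?thesis by (auto simp: alg_endos_def)
qed

lemma endo_eqI:
  assumes "\<alpha> \<in> alg_endos \<A>" "\<beta> \<in> alg_endos \<A>" "\<And>x. x \<in> Univ \<A> \<Longrightarrow> \<alpha> x = \<beta> x"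
  shows "\<alpha> = \<beta>"
  using assms by (auto simp: alg_endos_def intro: PiE_ext)

lemma restrict_id_in_endos:
  assumes "is_alg \<A>"
  shows "restrict (\<lambda>x. x) (Univ \<A>) \<in> alg_endos \<A>"
proof -
  have "map (restrict (\<lambda>x. x) (Univ \<A>)) xs = xs" if "set xs \<subseteq> Univ \<A>" for xs
    using that by (intro map_idI) auto
  then show ?thesis using assms by (force simp: alg_endos_def is_alg_def)
qed


section \<open>Independence algebras\<close>

locale indep_algebra =
  fixes \<A> :: "'a alg"
  assumes indep_alg: "independence_algebra \<A>"
begin

abbreviation "U \<equiv> Univ \<A>"
abbreviation "cl \<equiv> sub_gen \<A>"

lemma is_alg: "is_alg \<A>" and exch: "exchange_property \<A>" and free: "free_basis_property \<A>"
  using indep_alg by (auto simp: independence_algebra_def)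

lemma exchange: "X \<subseteq> U \<Longrightarrow> a \<in> U \<Longrightarrow> b \<in> cl (insert a X) \<Longrightarrow> b \<notin> cl X \<Longrightarrow> b \<in> U \<Longrightarrow>
    a \<in> cl (insert b X)"
  using exch by (auto simp: exchange_property_def)

lemma subalg_Univ: "subalg U \<A>"
  using is_alg by (auto simp: subalg_def is_alg_def)

lemma cl_Univ: "X \<subseteq> U \<Longrightarrow> cl X \<subseteq> U"
  using sub_gen_least subalg_Univ by blast

lemma subalg_cl:
  assumes "X \<subseteq> U"
  shows "subalg (cl X) \<A>"
  unfolding subalg_def
proof (intro conjI cl_Univ assms ballI, clarify)
  fix n f and xs :: "'a list"
  assume "(length xs, f) \<in> Ops \<A>" "set xs \<subseteq> cl X"
  then show "f xs \<in> cl X"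
    unfolding sub_gen_eq_op_closure by (intro op_closure.step[of "length xs" f]) auto
qed

lemma cl_subset: "X \<subseteq> U \<Longrightarrow> Y \<subseteq> cl X \<Longrightarrow> cl Y \<subseteq> cl X"
  by (simp add: sub_gen_least subalg_cl)

section \<open>Independent sets and bases\<close>

lemma indep_insert:
  assumes Y: "alg_indep \<A> Y" "Y \<subseteq> U" and c: "c \<in> U" "c \<notin> cl Y"
  shows "alg_indep \<A> (insert c Y)"
  unfolding alg_indep_def
proof (intro ballI notI)
  fix y assume y: "y \<in> insert c Y" "y \<in> cl (insert c Y - {y})"
  have "c \<notin> Y" using c(2) sub_gen_incr[of Y \<A>] by blast
  show False
  proof (cases "y = c")
    case True
    then show False using y(2) c(2) \<open>c \<notin> Y\<close> by simp
  next
    case False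
    then have "y \<in> Y" using y(1) by simp
    have "insert c Y - {y} = insert c (Y - {y})" using False by auto
    moreover have "y \<notin> cl (Y - {y})" using Y(1) \<open>y \<in> Y\<close> by (auto simp: alg_indep_def)
    \<comment> \<open>Exchange over \<open>Y - {y}\<close>: since \<open>y\<close> depends on this
      set only after \<open>c\<close> is added, \<open>c\<close> depends on it after
      \<open>y\<close> is added, that is, on \<open>Y\<close>.\<close>
    ultimately have "c \<in> cl (insert y (Y - {y}))"
      using exchange[of "Y - {y}" c y] y(2) Y(2) c(1) \<open>y \<in> Y\<close> by auto
    then show False using c(2) \<open>y \<in> Y\<close> by (simp add: insert_absorb)
  qed
qed

text \<open>A dependence of \<open>x\<close> needs only a finite \<open>F\<close>;
  \<open>insert x F\<close> lies in a single member of the chain, which would then be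
  dependent.\<close>

lemma indep_Union_chain:
  assumes "\<And>X. X \<in> \<C> \<Longrightarrow> alg_indep \<A> X" "subset.chain UNIV \<C>" "\<C> \<noteq> {}"
  shows "alg_indep \<A> (\<Union>\<C>)"
  unfolding alg_indep_def
proof (intro ballI notI)
  fix x assume x: "x \<in> \<Union>\<C>" "x \<in> cl (\<Union>\<C> - {x})"
  then obtain F where F: "finite F" "F \<subseteq> \<Union>\<C> - {x}" "x \<in> cl F"
    using sub_gen_finitary by metis
  have "finite (insert x F)" "insert x F \<subseteq> \<Union>\<C>" using F x by auto
  then obtain X where X: "X \<in> \<C>" "insert x F \<subseteq> X"
    using finite_subset_Union_chain[of "insert x F" \<C> UNIV] assms(2,3) by blast
  then have "x \<in> cl (X - {x})" using F(2,3) sub_gen_mono[of F "X - {x}"] by auto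
  then show False using assms(1) X by (auto simp: alg_indep_def)
qed

text \<open>Zorn's lemma gives a maximal independent set between \<open>I\<close> and
  \<open>C\<close>. It generates \<open>C\<close>, as by \<open>indep_insert\<close> any element of
  \<open>C\<close> outside its span could be added.\<close>

lemma extend_to_basis:
  assumes C: "subalg C \<A>" and I: "alg_indep \<A> I" "I \<subseteq> C"
  shows "\<exists>Y. I \<subseteq> Y \<and> alg_basis \<A> C Y"
proof -
  define \<F> where "\<F> = {Y. I \<subseteq> Y \<and> Y \<subseteq> C \<and> alg_indep \<A> Y}"
  have "\<F> \<noteq> {}" using I by (auto simp: \<F>_def)
  moreover have "\<Union>\<C> \<in> \<F>" if "\<C> \<noteq> {}" "subset.chain \<F> \<C>" for \<C>
  proof -
    have "alg_indep \<A> (\<Union>\<C>)"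
      using that by (intro indep_Union_chain) (auto simp: \<F>_def subset_chain_def)
    then show ?thesis using that by (auto simp: \<F>_def subset_chain_def)
  qed
  ultimately obtain Y where Y: "Y \<in> \<F>" "\<forall>X \<in> \<F>. Y \<subseteq> X \<longrightarrow> X = Y"
    using subset_Zorn_nonempty[of \<F>] by blast
  have CU: "C \<subseteq> U" using C by (simp add: subalg_def)
  have "c \<in> cl Y" if "c \<in> C" for c
  proof (rule ccontr)
    assume c: "c \<notin> cl Y"
    then have "insert c Y \<in> \<F>" using that Y(1) CU indep_insert[of Y c] by (auto simp: \<F>_def)
    then show False using Y(2) c sub_gen_incr[of "insert c Y" \<A>] sub_gen_incr[of Y \<A>] by blast
  qed
  then have "cl Y = C" using sub_gen_least[OF C] Y(1) by (auto simp: \<F>_def)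
  then show ?thesis using Y(1) by (auto simp: \<F>_def alg_basis_def)
qed

lemma ex_basis: "subalg C \<A> \<Longrightarrow> \<exists>Y. alg_basis \<A> C Y"
  using extend_to_basis[of C "{}"] by (auto simp: alg_indep_def)

lemma alg_dim_basis: "subalg C \<A> \<Longrightarrow> \<exists>X. alg_basis \<A> C X \<and> alg_dim \<A> C = |X|"
  unfolding alg_dim_def using someI_ex[OF ex_basis] by blast

section \<open>Images and extensions of endomorphisms\<close>

lemma endo_image_cl:
  assumes h: "h \<in> alg_endos \<A>" and X: "X \<subseteq> U"
  shows "h ` cl X = cl (h ` X)"
proof
  have hX: "h ` X \<subseteq> U" using X alg_endos_in_Univ[OF h] by auto
  have "v \<in> U \<and> h v \<in> cl (h ` X)" if "v \<in> op_closure \<A> X" for v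
    using that
  proof (induction rule: op_closure.induct)
    case (base x)
    then show ?case using X sub_gen_incr[of "h ` X" \<A>] by auto
  next
    case (step k f xs)
    have "f xs \<in> U"
      using step by (intro subalgD[OF subalg_Univ step.hyps(1,2)]) auto
    moreover have "h (f xs) = f (map h xs)"
      using step by (intro alg_endosD[OF h step.hyps(1,2)]) auto
    moreover have "f (map h xs) \<in> cl (h ` X)"
      using step by (intro subalgD[OF subalg_cl[OF hX] step.hyps(1)]) auto
    ultimately show ?case by simp
  qed
  then show "h ` cl X \<subseteq> cl (h ` X)" by (auto simp: sub_gen_eq_op_closure[of _ X])
  show "cl (h ` X) \<subseteq> h ` cl X"
  proof
    fix v assume "v \<in> cl (h ` X)"
    then show "v \<in> h ` cl X" unfolding sub_gen_eq_op_closure[of _ "h ` X"]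
    proof (induction rule: op_closure.induct)
      case (base x)
      then show ?case using sub_gen_incr[of X \<A>] by blast
    next
      case (step k f vs)
      then have "\<forall>v \<in> set vs. \<exists>u. u \<in> cl X \<and> h u = v" by auto
      then obtain g where g: "\<forall>v \<in> set vs. g v \<in> cl X \<and> h (g v) = v" by metis
      have gs: "set (map g vs) \<subseteq> cl X" using g by auto
      have "map h (map g vs) = vs" using g by (auto intro: map_idI)
      then have "f vs = h (f (map g vs))"
        using alg_endosD[OF h step.hyps(1), of "map g vs"] step.hyps(2) gs cl_Univ[OF X] by auto
      moreover have "f (map g vs) \<in> cl X"
        using subalgD[OF subalg_cl[OF X] step.hyps(1), of "map g vs"] step.hyps(2) gs by auto
      ultimately show ?case by simp
    qed
  qed
qed

lemma endo_image_subalg: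
  assumes "h \<in> alg_endos \<A>" "subalg C \<A>"
  shows "subalg (h ` C) \<A>"
proof -
  have C: "C \<subseteq> U" "cl C = C" using assms(2) by (auto simp: subalg_def sub_gen_subalg)
  then have "h ` C = cl (h ` C)" using endo_image_cl[OF assms(1), of C] by simp
  moreover have "h ` C \<subseteq> U" using C alg_endos_in_Univ[OF assms(1)] by auto
  ultimately show ?thesis using subalg_cl[of "h ` C"] by simp
qed

lemma endo_agree:
  assumes h: "h \<in> alg_endos \<A>" and g: "g \<in> alg_endos \<A>" and X: "X \<subseteq> U"
    and eq: "\<And>x. x \<in> X \<Longrightarrow> h x = g x" and v: "v \<in> cl X"
  shows "h v = g v"
proof -
  have "v \<in> U \<and> h v = g v"
    using v unfolding sub_gen_eq_op_closure
  proof (induction rule: op_closure.induct)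
    case (base x)
    then show ?case using X eq by auto
  next
    case (step k f xs)
    have xs: "set xs \<subseteq> U" "map h xs = map g xs" using step by auto
    then have "f xs \<in> U" using subalgD[OF subalg_Univ step.hyps(1,2)] by simp
    then show ?case
      using alg_endosD[OF h step.hyps(1,2)] alg_endosD[OF g step.hyps(1,2)] xs by simp
  qed
  then show ?thesis by simp
qed

lemma endo_fixes_cl:
  assumes "h \<in> alg_endos \<A>" "X \<subseteq> U" "\<And>x. x \<in> X \<Longrightarrow> h x = x" "v \<in> cl X"
  shows "h v = v"
proof -
  have "h v = restrict (\<lambda>x. x) U v"
    by (rule endo_agree[OF assms(1) restrict_id_in_endos[OF is_alg] assms(2) _ assms(4)])
      (use assms in auto)
  then show ?thesis using assms(2,4) cl_Univ by auto
qed

lemma free_extension: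
  assumes "alg_basis \<A> U X" "\<phi> \<in> X \<rightarrow> U"
  shows "\<exists>h \<in> alg_endos \<A>. \<forall>x \<in> X. h x = \<phi> x"
  using free assms by (auto simp: free_basis_property_def)

lemma ex_endo_map_point:
  assumes "a \<in> U" "a \<notin> cl {}" "b \<in> U"
  shows "\<exists>h \<in> alg_endos \<A>. h a = b"
proof -
  have "alg_indep \<A> {a}" using assms by (simp add: alg_indep_def)
  then obtain X where X: "{a} \<subseteq> X" "alg_basis \<A> U X"
    using extend_to_basis[OF subalg_Univ, of "{a}"] assms(1) by auto
  then show ?thesis using free_extension[OF X(2), of "\<lambda>_. b"] assms by auto
qed

text \<open>A basis \<open>Y\<close> of \<open>C\<close> extends to a basis of the whole algebra;
  fixing \<open>Y\<close> and sending the remaining basis elements to one point of \<open>C\<close>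
  gives the retraction. The point comes from \<open>C\<close> rather than from \<open>Y\<close>, as
  \<open>Y\<close> is empty when \<open>C\<close> consists of the constants.\<close>

lemma ex_retraction:
  assumes C: "subalg C \<A>" "C \<noteq> {}"
  shows "\<exists>h \<in> alg_endos \<A>. h ` U = C \<and> (\<forall>x \<in> C. h x = x)"
proof -
  have CU: "C \<subseteq> U" using C by (simp add: subalg_def)
  obtain c where c: "c \<in> C" using C(2) by blast
  obtain Y where Y: "alg_basis \<A> C Y" using ex_basis C(1) by blast
  then have Y': "Y \<subseteq> C" "alg_indep \<A> Y" "cl Y = C" by (auto simp: alg_basis_def)
  then obtain X where X: "Y \<subseteq> X" "alg_basis \<A> U X"
    using extend_to_basis[OF subalg_Univ, of Y] CU by auto
  then have X': "X \<subseteq> U" "cl X = U" by (auto simp: alg_basis_def)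
  obtain h where h: "h \<in> alg_endos \<A>" "\<forall>x \<in> X. h x = (if x \<in> Y then x else c)"
    using free_extension[OF X(2), of "\<lambda>x. if x \<in> Y then x else c"] Y' CU c by force
  have hX: "Y \<subseteq> h ` X" "h ` X \<subseteq> C" using h(2) X(1) Y'(1) c by force+
  have "h ` U = cl (h ` X)" using endo_image_cl[OF h(1) X'(1)] X'(2) by simp
  also have "\<dots> = C" using sub_gen_least[OF C(1) hX(2)] sub_gen_mono[OF hX(1), of \<A>] Y'(3) by auto
  finally have "h ` U = C" .
  moreover have "h x = x" if "x \<in> C" for x
    by (rule endo_fixes_cl[OF h(1), of Y]) (use that h X Y' CU in auto)
  ultimately show ?thesis using h(1) by blast
qed

text \<open>For a subalgebra \<open>M\<close> this says that \<open>M\<close> is minimal among the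
  non-empty subalgebras. It expresses rank \<open>e\<close> without dimensions: such an
  \<open>M\<close> is \<open>cl {}\<close> if there are constants, and otherwise any one-generated
  subalgebra.\<close>

definition min_sub :: "'a set \<Rightarrow> bool" where
  "min_sub M \<longleftrightarrow> M \<noteq> {} \<and> (\<forall>x \<in> M. cl {x} = M)"

text \<open>A constant \<open>c\<close> lies in every subalgebra and so generates \<open>M\<close>,
  yet it generates nothing outside \<open>cl {}\<close>.\<close>

lemma min_sub_eq_constants:
  assumes "cl {} \<noteq> {}" "min_sub M" "subalg M \<A>"
  shows "M = cl {}"
proof -
  obtain c where c: "c \<in> cl {}" using assms(1) by blast
  have "cl {} \<subseteq> M" using sub_gen_least[OF assms(3)] by simp
  moreover from this have "cl {c} = M" using c assms(2) by (auto simp: min_sub_def)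
  moreover have "cl {c} \<subseteq> cl {}" using cl_subset[of "{}" "{c}"] c by simp
  ultimately show ?thesis by simp
qed

lemma min_sub_constants: "cl {} \<noteq> {} \<Longrightarrow> min_sub (cl {})"
  using cl_subset[of "{}" "{_}"] sub_gen_mono[of "{}" "{_}" \<A>]
  by (auto simp: min_sub_def)

text \<open>Exchange over the empty set: with no constants, an element \<open>y\<close> generated by
  \<open>x\<close> generates \<open>x\<close> in turn.\<close>

lemma min_sub_point:
  assumes e: "cl {} = {}" and x: "x \<in> U"
  shows "min_sub (cl {x})"
  unfolding min_sub_def
proof (intro conjI ballI)
  show "cl {x} \<noteq> {}" using sub_gen_incr[of "{x}" \<A>] by blast
  fix y assume y: "y \<in> cl {x}"
  have "y \<in> U" using y cl_Univ[of "{x}"] x by auto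
  moreover have "x \<in> cl {y}" using exchange[of "{}" x y] e x y \<open>y \<in> U\<close> by simp
  ultimately show "cl {y} = cl {x}"
    using cl_subset[of "{x}" "{y}"] cl_subset[of "{y}" "{x}"] x y by auto
qed

lemma min_sub_subalg_eq: "min_sub M \<Longrightarrow> subalg C \<A> \<Longrightarrow> C \<noteq> {} \<Longrightarrow> C \<subseteq> M \<Longrightarrow> C = M"
  unfolding min_sub_def using sub_gen_least[of C \<A> "{_}"] by blast

lemma min_sub_image:
  assumes M: "min_sub M" "M \<subseteq> U" and h: "h \<in> alg_endos \<A>"
  shows "min_sub (h ` M)"
  unfolding min_sub_def
proof (intro conjI ballI)
  show "h ` M \<noteq> {}" using M by (simp add: min_sub_def)
  fix y assume "y \<in> h ` M"
  then obtain x where x: "x \<in> M" "y = h x" by blast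
  then have "cl {y} = h ` cl {x}" using endo_image_cl[OF h, of "{x}"] M(2) by auto
  then show "cl {y} = h ` M" using M(1) x by (simp add: min_sub_def)
qed

text \<open>Distinct basis elements of a minimal subalgebra would generate each other, against
  independence. If there are constants, a minimal \<open>C\<close> is generated by the empty set,
  which leaves no room for a basis element.\<close>

lemma min_sub_basis:
  assumes X: "alg_basis \<A> C X" and C: "C \<subseteq> U" "C \<noteq> {}"
  shows "min_sub C \<longleftrightarrow> (if cl {} \<noteq> {} then X = {} else \<exists>x. X = {x})"
proof -
  have X': "X \<subseteq> C" "cl X = C" "\<And>x. x \<in> X \<Longrightarrow> x \<notin> cl (X - {x})"
    using X by (auto simp: alg_basis_def alg_indep_def)
  have sub: "subalg C \<A>" using subalg_cl[of X] X' C by auto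
  show ?thesis
  proof (cases "cl {} = {}")
    case True
    have "\<exists>x. X = {x}" if m: "min_sub C"
    proof -
      have "X \<noteq> {}" using True X'(2) C(2) by auto
      then obtain x where x: "x \<in> X" by blast
      have "y = x" if y: "y \<in> X" for y
      proof (rule ccontr)
        assume "y \<noteq> x"
        then have "cl {x} \<subseteq> cl (X - {y})" using x by (intro sub_gen_mono) auto
        moreover have "y \<in> cl {x}" using m x y X'(1) by (auto simp: min_sub_def)
        ultimately show False using X'(3) y by blast
      qed
      then show ?thesis using x by blast
    qed
    moreover have "min_sub C" if "X = {x}" for x
      using min_sub_point[OF True, of x] X' C that by auto
    ultimately show ?thesis using True by auto
  next
    case False
    have "X = {}" if "min_sub C"
    proof -
      have "C = cl {}" using min_sub_eq_constants[OF False that sub] .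
      then have "x \<notin> X" for x using X' sub_gen_mono[of "{}" "X - {x}" \<A>] by blast
      then show ?thesis by blast
    qed
    then show ?thesis using False min_sub_constants X'(2) by auto
  qed
qed

text \<open>Supplies the data for \<open>ex_same_image_not_onto\<close>: a basis element
  \<open>z\<close> to be missed, and a point \<open>c\<close> of the subalgebra spanned by the
  others. Here \<open>c\<close> is a constant or, without constants, a second basis element.\<close>

lemma not_min_sub_basis:
  assumes X: "alg_basis \<A> C X" and C: "C \<subseteq> U" "C \<noteq> {}" and "\<not> min_sub C"
  shows "\<exists>z c. z \<in> X \<and> c \<in> cl (X - {z})"
proof (cases "cl {} = {}")
  case False
  then obtain z where "z \<in> X" using min_sub_basis[OF X C] assms(4) by auto
  then show ?thesis using False sub_gen_mono[of "{}" "X - {z}" \<A>] by blast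
next
  case True
  have "X \<noteq> {}" using True X C(2) by (auto simp: alg_basis_def)
  moreover have "\<nexists>x. X = {x}" using True min_sub_basis[OF X C] assms(4) by simp
  ultimately obtain z c where "z \<in> X" "c \<in> X - {z}" by blast
  then show ?thesis using sub_gen_incr[of "X - {z}" \<A>] by blast
qed

text \<open>Both forms agree because without constants a non-empty \<open>C\<close> has no empty
  basis. As \<open>X\<close> is an arbitrary basis, the result applies to the one that
  \<open>alg_dim\<close> picks.\<close>

lemma min_sub_basis_card:
  assumes X: "alg_basis \<A> C X" and C: "C \<subseteq> U" "C \<noteq> {}"
    and e: "e = (if cl {} \<noteq> {} then 0 else (1::nat))"
  shows "min_sub C \<longleftrightarrow> |X| <o |{..<e + 1}|" and "min_sub C \<longleftrightarrow> |X| =o |{..<e}|"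
proof -
  have nonempty: "X \<noteq> {}" if "cl {} = {}"
    using that X C(2) by (auto simp: alg_basis_def)
  have le: "|X| <o |{..<n::nat}| \<longleftrightarrow> finite X \<and> card X < n" for n
    by (simp add: finite_card_of_ordLess_iff)
  have eq: "|X| =o |{..<n::nat}| \<longleftrightarrow> finite X \<and> card X = n" for n
    by (simp add: finite_card_of_ordIso_iff)
  show "min_sub C \<longleftrightarrow> |X| <o |{..<e + 1}|"
    unfolding le min_sub_basis[OF X C] using nonempty e
    by (auto simp: less_Suc_eq card_1_singleton_iff)
  show "min_sub C \<longleftrightarrow> |X| =o |{..<e}|"
    unfolding eq min_sub_basis[OF X C] using e by (auto simp: card_1_singleton_iff)
qed

end


section \<open>Endomorphisms with restricted range\<close>

lemma equiv_L_tilde: "equiv S (L_tilde S m)"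
  by (auto simp: equiv_def refl_on_def sym_def trans_def L_tilde_def)

lemma equiv_R_tilde: "equiv S (R_tilde S m)"
  by (auto simp: equiv_def refl_on_def sym_def trans_def R_tilde_def)

lemma saturated_closed:
  assumes "equiv S r" "saturated_by S r I" "(a, b) \<in> r"
  shows "a \<in> I \<longleftrightarrow> b \<in> I"
proof -
  obtain C where C: "C \<subseteq> S // r" "I = \<Union>C" using assms(2) by (auto simp: saturated_by_def)
  have "a \<in> X \<longleftrightarrow> b \<in> X" if "X \<in> S // r" for X
    using in_quotient_imp_closed[OF assms(1) that] assms(1,3) by (metis equivE symD)
  then show ?thesis using C by blast
qed

lemma closed_saturated:
  assumes "equiv S r" "I \<subseteq> S" "\<And>a b. (a, b) \<in> r \<Longrightarrow> a \<in> I \<Longrightarrow> b \<in> I"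
  shows "saturated_by S r I"
proof -
  have "I = \<Union>((\<lambda>a. r `` {a}) ` I)"
    using assms by (auto simp: equiv_def refl_on_def)
  moreover have "(\<lambda>a. r `` {a}) ` I \<subseteq> S // r" using assms(2) by (auto simp: quotient_def)
  ultimately show ?thesis unfolding saturated_by_def by metis
qed

text \<open>\<open>B_not_min\<close> is the form that the assumption on the dimension of
  \<open>B\<close> takes here: the dimension exceeds \<open>e\<close>.\<close>

locale restricted_range = indep_algebra \<A> for \<A> :: "'a alg" +
  fixes B :: "'a set"
  assumes subalg_B: "subalg B \<A>" and B_nonempty: "B \<noteq> {}" and B_proper: "B \<noteq> Univ \<A>"
    and B_not_min: "\<not> min_sub B"
begin

abbreviation "T \<equiv> endos_into \<A> B"
abbreviation "mult \<equiv> endo_mult \<A>"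

definition Tmin :: "('a \<Rightarrow> 'a) set" where
  "Tmin = {\<alpha> \<in> T. min_sub (\<alpha> ` U)}"

lemma T_iff: "\<alpha> \<in> T \<longleftrightarrow> \<alpha> \<in> alg_endos \<A> \<and> (\<forall>x \<in> U. \<alpha> x \<in> B)"
  by (auto simp: endos_into_def)

lemma B_sub: "B \<subseteq> U"
  using subalg_B by (simp add: subalg_def)

lemma T_in_U: "\<alpha> \<in> T \<Longrightarrow> x \<in> U \<Longrightarrow> \<alpha> x \<in> U"
  using B_sub by (auto simp: T_iff)

lemma mult_in_T: "\<alpha> \<in> alg_endos \<A> \<Longrightarrow> \<beta> \<in> T \<Longrightarrow> mult \<alpha> \<beta> \<in> T"
  by (auto simp: T_iff endo_mult_in_endos is_alg alg_endos_in_Univ)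

lemma mult_eq_iff:
  assumes "\<alpha> \<in> alg_endos \<A>" "\<beta> \<in> alg_endos \<A>" "\<gamma> \<in> alg_endos \<A>"
  shows "mult \<alpha> \<beta> = \<gamma> \<longleftrightarrow> (\<forall>x \<in> U. \<beta> (\<alpha> x) = \<gamma> x)"
  using endo_eqI[OF endo_mult_in_endos[OF assms(1,2) is_alg] assms(3)] by auto

lemma idem_iff: "f \<in> sg_idems T mult \<longleftrightarrow> f \<in> T \<and> (\<forall>x \<in> U. f (f x) = f x)"
  using mult_eq_iff by (auto simp: sg_idems_def T_iff)

lemma image_sub_B: "\<alpha> \<in> T \<Longrightarrow> \<alpha> ` U \<subseteq> B"
  by (simp add: endos_into_def)

lemma subalg_image: "\<alpha> \<in> T \<Longrightarrow> subalg (\<alpha> ` U) \<A>"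
  using endo_image_subalg subalg_Univ by (auto simp: T_iff)

lemma image_nonempty: "\<alpha> ` U \<noteq> {}"
  using is_alg by (simp add: is_alg_def)

lemma ex_idem_onto:
  assumes "subalg C \<A>" "C \<noteq> {}" "C \<subseteq> B"
  shows "\<exists>f \<in> sg_idems T mult. f ` U = C \<and> (\<forall>x \<in> C. f x = x)"
proof -
  obtain f where f: "f \<in> alg_endos \<A>" "f ` U = C" "\<forall>x \<in> C. f x = x"
    using ex_retraction[OF assms(1,2)] by blast
  moreover from this have "f \<in> sg_idems T mult" using assms(3) by (auto simp: idem_iff T_iff)
  ultimately show ?thesis by blast
qed

section \<open>The relations L-tilde and R-tilde\<close>

lemma L_tilde_iff:
  "(\<alpha>, \<beta>) \<in> L_tilde T mult \<longleftrightarrow> \<alpha> \<in> T \<and> \<beta> \<in> T \<and> \<alpha> ` U = \<beta> ` U"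
proof -
  have fix_iff: "mult \<alpha> f = \<alpha> \<longleftrightarrow> (\<forall>y \<in> \<alpha> ` U. f y = y)"
    if "\<alpha> \<in> T" "f \<in> sg_idems T mult" for \<alpha> f
    using that by (auto simp: idem_iff T_iff mult_eq_iff)
  have sub: "\<beta> ` U \<subseteq> \<alpha> ` U" if "(\<alpha>, \<beta>) \<in> L_tilde T mult" for \<alpha> \<beta>
  proof -
    have ab: "\<alpha> \<in> T" "\<beta> \<in> T" using that by (auto simp: L_tilde_def)
    \<comment> \<open>The test idempotent has exactly the image of \<alpha>. It fixes \<alpha> from
      the right, hence also \<beta>, so the image of \<beta> lies in that of
      \<open>f\<close>.\<close>
    obtain f where f: "f \<in> sg_idems T mult" "f ` U = \<alpha> ` U" "\<forall>x \<in> \<alpha> ` U. f x = x"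
      using ex_idem_onto[OF subalg_image[OF ab(1)] image_nonempty image_sub_B[OF ab(1)]] by blast
    then have "mult \<beta> f = \<beta>" using that fix_iff[OF ab(1)] by (auto simp: L_tilde_def)
    then have "f ` \<beta> ` U = \<beta> ` U" using fix_iff[OF ab(2) f(1)] by (force simp: image_image)
    moreover have "f ` \<beta> ` U \<subseteq> f ` U" using T_in_U[OF ab(2)] by (intro image_mono) auto
    ultimately show ?thesis using f(2) by simp
  qed
  show ?thesis
  proof
    assume L: "(\<alpha>, \<beta>) \<in> L_tilde T mult"
    then have "(\<beta>, \<alpha>) \<in> L_tilde T mult" "\<alpha> \<in> T" "\<beta> \<in> T" by (auto simp: L_tilde_def)
    then show "\<alpha> \<in> T \<and> \<beta> \<in> T \<and> \<alpha> ` U = \<beta> ` U" using sub[of \<alpha> \<beta>] sub[of \<beta> \<alpha>] L by simp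
  next
    assume "\<alpha> \<in> T \<and> \<beta> \<in> T \<and> \<alpha> ` U = \<beta> ` U"
    then show "(\<alpha>, \<beta>) \<in> L_tilde T mult"
      using fix_iff[of \<alpha>] fix_iff[of \<beta>] by (simp add: L_tilde_def)
  qed
qed

text \<open>If f \<alpha> = \<alpha> with \<open>f\<close> into \<open>B\<close>, then every value
  of \<alpha> is already taken on \<open>B\<close>. So neither map is fixed from the left by any
  idempotent, and the defining equivalence holds trivially.\<close>

lemma R_tilde_not_onto:
  assumes "\<alpha> \<in> T" "\<beta> \<in> T" "\<alpha> ` B \<noteq> \<alpha> ` U" "\<beta> ` B \<noteq> \<beta> ` U"
  shows "(\<alpha>, \<beta>) \<in> R_tilde T mult"
proof -
  have "mult f \<alpha> \<noteq> \<alpha>" if "f \<in> T" "\<alpha> \<in> T" "\<alpha> ` B \<noteq> \<alpha> ` U" for f \<alpha>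
  proof
    assume "mult f \<alpha> = \<alpha>"
    then have "\<forall>x \<in> U. \<alpha> (f x) = \<alpha> x" by (metis endo_mult_apply)
    moreover have "\<forall>x \<in> U. f x \<in> B" using that(1) by (simp add: T_iff)
    ultimately have "\<alpha> ` U \<subseteq> \<alpha> ` B" by (metis image_eqI image_subsetI)
    then show False using that(3) B_sub by blast
  qed
  then show ?thesis using assms by (auto simp: R_tilde_def sg_idems_def)
qed

text \<open>Being fixed from the left by \<open>f\<close> depends only on the kernel of \<alpha>,
  and two maps that factor through each other have the same kernel.\<close>

lemma R_tilde_mutual_factor:
  assumes T: "\<alpha> \<in> T" "\<beta> \<in> T" and "\<forall>x \<in> U. \<beta> x = \<theta> (\<alpha> x)" "\<forall>x \<in> U. \<alpha> x = \<phi> (\<beta> x)"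
  shows "(\<alpha>, \<beta>) \<in> R_tilde T mult"
proof -
  have "mult f \<alpha> = \<alpha> \<longleftrightarrow> mult f \<beta> = \<beta>" if f: "f \<in> T" for f
  proof -
    have "mult f \<alpha> = \<alpha> \<longleftrightarrow> (\<forall>x \<in> U. \<alpha> (f x) = \<alpha> x)" "mult f \<beta> = \<beta> \<longleftrightarrow> (\<forall>x \<in> U. \<beta> (f x) = \<beta> x)"
      using T f mult_eq_iff by (auto simp: T_iff)
    then show ?thesis using assms(3,4) T_in_U[OF f] by metis
  qed
  then show ?thesis using T by (auto simp: R_tilde_def sg_idems_def)
qed

text \<open>Makes every map outside \<open>Tmin\<close> L-tilde-related to one to which
  \<open>R_tilde_not_onto\<close> applies. The bases \<open>Z\<close>, \<open>Y\<close>,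
  \<open>X\<close> of the image, of \<open>B\<close> and of the whole algebra are nested, so that
  one assignment on \<open>X\<close> controls all three.\<close>

lemma ex_same_image_not_onto:
  assumes \<alpha>: "\<alpha> \<in> T" "\<alpha> \<notin> Tmin"
  shows "\<exists>\<beta> \<in> T. \<beta> ` U = \<alpha> ` U \<and> \<beta> ` B \<noteq> \<beta> ` U"
proof -
  define C where "C = \<alpha> ` U"
  have C: "subalg C \<A>" "C \<noteq> {}" "C \<subseteq> B" "\<not> min_sub C"
    using \<alpha> subalg_image image_nonempty by (auto simp: C_def Tmin_def T_iff)
  have CU: "C \<subseteq> U" using C(3) B_sub by blast
  obtain Z where Z: "alg_basis \<A> C Z" using ex_basis C(1) by blast
  then have Z': "Z \<subseteq> C" "alg_indep \<A> Z" "cl Z = C" by (auto simp: alg_basis_def)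
  obtain z c where zc: "z \<in> Z" "c \<in> cl (Z - {z})"
    using not_min_sub_basis[OF Z CU C(2,4)] by blast
  define D where "D = cl (Z - {z})"
  have D: "subalg D \<A>" "D \<subseteq> C" "z \<notin> D" "c \<in> D" "Z - {z} \<subseteq> D"
    using subalg_cl[of "Z - {z}"] Z' CU zc sub_gen_mono[of "Z - {z}" Z \<A>] sub_gen_incr[of "Z - {z}" \<A>]
    by (auto simp: D_def alg_indep_def)
  obtain Y where Y: "Z \<subseteq> Y" "alg_basis \<A> B Y"
    using extend_to_basis[OF subalg_B Z'(2)] Z'(1) C(3) by blast
  then have Y': "Y \<subseteq> B" "alg_indep \<A> Y" "cl Y = B" by (auto simp: alg_basis_def)
  obtain X where X: "Y \<subseteq> X" "alg_basis \<A> U X"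
    using extend_to_basis[OF subalg_Univ Y'(2)] Y'(1) B_sub by blast
  then have X': "X \<subseteq> U" "cl X = U" by (auto simp: alg_basis_def)
  \<comment> \<open>\<open>Y\<close> generates only \<open>B\<close>, a proper subalgebra, so the
    basis \<open>X\<close> has an element outside \<open>Y\<close>.\<close>
  obtain w where w: "w \<in> X" "w \<notin> Y" using X(1) X'(2) Y'(3) B_proper by (metis subsetI subset_antisym)
  \<comment> \<open>All of \<open>Y\<close>, \<open>z\<close> included, goes into \<open>D\<close>,
    so the image of \<open>B\<close> misses \<open>z\<close>; the elements of \<open>X\<close>
    outside \<open>Y\<close>, such as \<open>w\<close>, bring \<open>z\<close> back into the
    image.\<close>
  define \<phi> where "\<phi> x = (if x \<in> Z - {z} then x else if x \<in> Y then c else z)" for x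
  have \<phi>Y: "\<phi> ` Y \<subseteq> D" using D by (auto simp: \<phi>_def)
  have zC: "z \<in> C" using zc Z' by blast
  have \<phi>X: "\<phi> ` X \<subseteq> C" using D zC by (auto simp: \<phi>_def)
  have Z\<phi>: "Z \<subseteq> \<phi> ` X"
  proof
    fix x assume x: "x \<in> Z"
    show "x \<in> \<phi> ` X"
    proof (cases "x = z")
      case True
      have "\<phi> w = z" using w Y(1) by (auto simp: \<phi>_def)
      then show ?thesis using w(1) True by blast
    next
      case False
      then have "\<phi> x = x" using x by (simp add: \<phi>_def)
      then show ?thesis using x Y(1) X(1) by (metis imageI subsetD)
    qed
  qed
  obtain \<beta> where \<beta>: "\<beta> \<in> alg_endos \<A>" "\<forall>x \<in> X. \<beta> x = \<phi> x"
    using free_extension[OF X(2), of \<phi>] \<phi>X CU by blast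
  have im: "\<beta> ` X = \<phi> ` X" "\<beta> ` Y = \<phi> ` Y" using \<beta>(2) X(1) by (auto intro!: image_cong)
  have "\<beta> ` U = cl (\<phi> ` X)" using endo_image_cl[OF \<beta>(1) X'(1)] X'(2) im by simp
  then have \<beta>U: "\<beta> ` U = C"
    using sub_gen_least[OF C(1) \<phi>X] sub_gen_mono[OF Z\<phi>, of \<A>] Z'(3) by auto
  have "Y \<subseteq> U" using Y'(1) B_sub by blast
  then have "\<beta> ` B = cl (\<phi> ` Y)" using endo_image_cl[OF \<beta>(1), of Y] Y'(3) im by simp
  then have "\<beta> ` B \<subseteq> D" using sub_gen_least[OF D(1) \<phi>Y] by simp
  then have "\<beta> ` B \<noteq> \<beta> ` U" using \<beta>U zC D(3) by blast
  moreover have "\<beta> \<in> T" using \<beta>(1) \<beta>U C(3) by (auto simp: T_iff)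
  ultimately show ?thesis using \<beta>U C_def by blast
qed

section \<open>Maps with minimal image\<close>

lemma Tmin_L_R:
  assumes \<alpha>: "\<alpha> \<in> Tmin" and \<beta>: "\<beta> \<in> Tmin"
  shows "\<exists>\<gamma>. (\<alpha>, \<gamma>) \<in> R_tilde T mult \<and> (\<gamma>, \<beta>) \<in> L_tilde T mult"
proof (cases "cl {} = {}")
  case False
  have ab: "\<alpha> \<in> T" "\<beta> \<in> T" using assms by (auto simp: Tmin_def)
  have "\<alpha> ` U = \<beta> ` U"
    using min_sub_eq_constants[OF False _ subalg_image[OF ab(1)]]
      min_sub_eq_constants[OF False _ subalg_image[OF ab(2)]] assms
    by (simp add: Tmin_def)
  then have "(\<alpha>, \<beta>) \<in> L_tilde T mult" using ab by (simp add: L_tilde_iff)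
  moreover have "(\<alpha>, \<alpha>) \<in> R_tilde T mult" using ab by (simp add: R_tilde_def)
  ultimately show ?thesis by blast
next
  case True
  have ab: "\<alpha> \<in> T" "\<beta> \<in> T" using assms by (auto simp: Tmin_def)
  obtain a b where a: "a \<in> \<alpha> ` U" and b: "b \<in> \<beta> ` U"
    using image_nonempty[of \<alpha>] image_nonempty[of \<beta>] by blast
  then have aU: "a \<in> U" and bU: "b \<in> U" using T_in_U ab by auto
  have cla: "cl {a} = \<alpha> ` U" and clb: "cl {b} = \<beta> ` U"
    using assms a b by (auto simp: Tmin_def min_sub_def)
  \<comment> \<open>\<theta> and \<phi> interchange the generators of the two images and so restrict
    to mutually inverse maps between them. Hence \<alpha> \<theta> has the kernel of \<alpha> and
    the image of \<beta>.\<close>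
  obtain \<theta> \<phi> where \<theta>: "\<theta> \<in> alg_endos \<A>" "\<theta> a = b" and \<phi>: "\<phi> \<in> alg_endos \<A>" "\<phi> b = a"
    using ex_endo_map_point[OF aU _ bU] ex_endo_map_point[OF bU _ aU] True by auto
  have \<theta>\<phi>: "\<phi> (\<theta> y) = y" if "y \<in> \<alpha> ` U" for y
  proof -
    have "y \<in> cl {a}" using that cla by simp
    moreover have "mult \<theta> \<phi> a = a" using aU \<theta> \<phi> by simp
    ultimately have "mult \<theta> \<phi> y = y"
      using endo_fixes_cl[OF endo_mult_in_endos[OF \<theta>(1) \<phi>(1) is_alg], of "{a}"] aU by auto
    then show ?thesis using that T_in_U[OF ab(1)] by auto
  qed
  define \<gamma> where "\<gamma> = mult \<alpha> \<theta>"
  have "\<gamma> ` U = \<theta> ` (\<alpha> ` U)" by (auto simp: \<gamma>_def image_image)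
  also have "\<dots> = \<beta> ` U" using endo_image_cl[OF \<theta>(1), of "{a}"] aU \<theta>(2) cla clb by simp
  finally have im: "\<gamma> ` U = \<beta> ` U" .
  have "\<gamma> \<in> alg_endos \<A>"
    using endo_mult_in_endos[OF _ \<theta>(1) is_alg] ab(1) by (simp add: \<gamma>_def T_iff)
  then have \<gamma>T: "\<gamma> \<in> T" using im ab(2) by (auto simp: endos_into_def)
  have "(\<alpha>, \<gamma>) \<in> R_tilde T mult"
    by (rule R_tilde_mutual_factor[of _ _ \<theta> \<phi>]) (use ab \<gamma>T \<theta>\<phi> in \<open>auto simp: \<gamma>_def\<close>)
  then show ?thesis using im \<gamma>T ab by (auto simp: L_tilde_iff)
qed

lemma Tmin_left_idem:
  assumes \<alpha>: "\<alpha> \<in> Tmin"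
  shows "\<exists>f \<in> sg_idems T mult. mult f \<alpha> = \<alpha> \<and> f \<in> Tmin"
proof (cases "cl {} = {}")
  case False
  have aT: "\<alpha> \<in> T" using \<alpha> by (simp add: Tmin_def)
  have "\<alpha> ` U = cl {}"
    using min_sub_eq_constants[OF False _ subalg_image[OF aT]] \<alpha> by (simp add: Tmin_def)
  \<comment> \<open>With constants, \<alpha> fixes its image \<open>cl {}\<close> pointwise, so it
    is itself the required idempotent.\<close>
  then have "\<forall>x \<in> U. \<alpha> (\<alpha> x) = \<alpha> x"
    using endo_fixes_cl[of \<alpha> "{}"] aT by (auto simp: T_iff)
  then have "\<alpha> \<in> sg_idems T mult" using aT by (simp add: idem_iff)
  then show ?thesis using \<alpha> by (auto simp: sg_idems_def)
next
  case True
  have aT: "\<alpha> \<in> T" "\<alpha> \<in> alg_endos \<A>" using \<alpha> by (auto simp: Tmin_def T_iff)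
  obtain b where b: "b \<in> B" using B_nonempty by blast
  then have bU: "b \<in> U" using B_sub by blast
  \<comment> \<open>\<theta> will send the generator \<open>a\<close> of the image back to
    \<open>b\<close>, so \<theta> \<alpha> is the identity on that image; then f = \<alpha> \<theta>
    satisfies f \<alpha> = \<alpha> and f f = f. Taking \<open>b\<close> in \<open>B\<close> keeps
    the image \<open>cl {b}\<close> of \<open>f\<close> inside \<open>B\<close>.\<close>
  define a where "a = \<alpha> b"
  have aU: "a \<in> U" using T_in_U aT bU by (simp add: a_def)
  have cla: "cl {a} = \<alpha> ` U" using \<alpha> bU by (auto simp: a_def Tmin_def min_sub_def)
  obtain \<theta> where \<theta>: "\<theta> \<in> alg_endos \<A>" "\<theta> a = b"
    using ex_endo_map_point[OF aU _ bU] True by auto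
  have \<theta>\<alpha>: "\<alpha> (\<theta> y) = y" if "y \<in> \<alpha> ` U" for y
  proof -
    have "y \<in> cl {a}" using that cla by simp
    moreover have "mult \<theta> \<alpha> a = a" using aU \<theta> by (simp add: a_def)
    ultimately have "mult \<theta> \<alpha> y = y"
      using endo_fixes_cl[OF endo_mult_in_endos[OF \<theta>(1) aT(2) is_alg], of "{a}"] aU by auto
    then show ?thesis using that T_in_U[OF aT(1)] by auto
  qed
  define f where "f = mult \<alpha> \<theta>"
  have fe: "f \<in> alg_endos \<A>" using endo_mult_in_endos[OF aT(2) \<theta>(1) is_alg] by (simp add: f_def)
  have "f ` U = \<theta> ` cl {a}" using cla by (auto simp: f_def image_image)
  then have im: "f ` U = cl {b}" using endo_image_cl[OF \<theta>(1), of "{a}"] aU \<theta>(2) by simp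
  then have "f ` U \<subseteq> B" using sub_gen_least[OF subalg_B, of "{b}"] b by simp
  then have fT: "f \<in> T" using fe by (simp add: endos_into_def)
  have f\<alpha>: "\<forall>x \<in> U. \<alpha> (f x) = \<alpha> x" using \<theta>\<alpha> by (simp add: f_def)
  then have "mult f \<alpha> = \<alpha>" using mult_eq_iff[OF fe aT(2) aT(2)] by simp
  moreover have "\<forall>x \<in> U. f (f x) = f x" using f\<alpha> T_in_U[OF fT] by (simp add: f_def)
  ultimately show ?thesis
    using fT im min_sub_point[OF True bU] by (auto simp: idem_iff Tmin_def)
qed

lemma mult_Tmin_left:
  assumes a: "\<alpha> \<in> Tmin" and b: "\<beta> \<in> T"
  shows "mult \<alpha> \<beta> \<in> Tmin"
proof -
  have "mult \<alpha> \<beta> ` U = \<beta> ` \<alpha> ` U" by (auto simp: image_image)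
  moreover have "\<alpha> ` U \<subseteq> U" using a T_in_U by (auto simp: Tmin_def)
  ultimately show ?thesis
    using min_sub_image[of "\<alpha> ` U" \<beta>] a b mult_in_T by (auto simp: Tmin_def T_iff)
qed

lemma mult_Tmin_right:
  assumes a: "\<alpha> \<in> Tmin" and b: "\<beta> \<in> T"
  shows "mult \<beta> \<alpha> \<in> Tmin"
proof -
  have T: "mult \<beta> \<alpha> \<in> T" using a b mult_in_T by (auto simp: Tmin_def T_iff)
  have "mult \<beta> \<alpha> ` U \<subseteq> \<alpha> ` U" using T_in_U[OF b] by auto
  then have "mult \<beta> \<alpha> ` U = \<alpha> ` U"
    using min_sub_subalg_eq[OF _ subalg_image[OF T] image_nonempty] a by (simp add: Tmin_def)
  then show ?thesis using a T by (simp add: Tmin_def)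
qed

section \<open>The two classes and the saturated ideals\<close>

definition two_classes :: "('a \<Rightarrow> 'a) rel" where
  "two_classes = Tmin \<times> Tmin \<union> (T - Tmin) \<times> (T - Tmin)"

lemma Tmin_sub: "Tmin \<subseteq> T"
  by (auto simp: Tmin_def)

lemma equiv_two_classes: "equiv T two_classes"
  using Tmin_sub by (auto simp: two_classes_def equiv_def refl_on_def sym_def trans_def)

lemma L_tilde_sub: "L_tilde T mult \<subseteq> two_classes"
  by (auto simp: L_tilde_iff two_classes_def Tmin_def)

text \<open>An idempotent of \<open>Tmin\<close> that fixes \<alpha> from the left also fixes
  \<beta>, which makes \<beta> a product with left factor in \<open>Tmin\<close>.\<close>

lemma R_tilde_sub: "R_tilde T mult \<subseteq> two_classes"
proof -
  have "\<beta> \<in> Tmin" if R: "(\<alpha>, \<beta>) \<in> R_tilde T mult" and \<alpha>: "\<alpha> \<in> Tmin" for \<alpha> \<beta>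
  proof -
    obtain f where f: "f \<in> sg_idems T mult" "mult f \<alpha> = \<alpha>" "f \<in> Tmin"
      using Tmin_left_idem[OF \<alpha>] by blast
    then have "mult f \<beta> = \<beta>" "\<beta> \<in> T" using R by (auto simp: R_tilde_def)
    then show ?thesis using mult_Tmin_left[OF f(3), of \<beta>] by simp
  qed
  moreover have "(\<beta>, \<alpha>) \<in> R_tilde T mult" if "(\<alpha>, \<beta>) \<in> R_tilde T mult" for \<alpha> \<beta>
    using that by (auto simp: R_tilde_def)
  moreover have "R_tilde T mult \<subseteq> T \<times> T" by (auto simp: R_tilde_def)
  ultimately show ?thesis unfolding two_classes_def by blast
qed

text \<open>Inside \<open>Tmin\<close> one R-tilde step and one L-tilde step suffice. Outside, the
  path is L-tilde, R-tilde, L-tilde: both maps are first replaced by maps with the same images that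
  do not send \<open>B\<close> onto them.\<close>

lemma two_classes_least:
  assumes r: "equiv T r" "L_tilde T mult \<subseteq> r" "R_tilde T mult \<subseteq> r"
  shows "two_classes \<subseteq> r"
proof -
  have sym: "(a, b) \<in> r \<Longrightarrow> (b, a) \<in> r" and trans: "(a, b) \<in> r \<Longrightarrow> (b, c) \<in> r \<Longrightarrow> (a, c) \<in> r"
    for a b c using r(1) by (meson equivE symD transD)+
  have "(\<alpha>, \<beta>) \<in> r" if "\<alpha> \<in> Tmin" "\<beta> \<in> Tmin" for \<alpha> \<beta>
    using Tmin_L_R[OF that] trans r(2,3) by blast
  moreover have "(\<alpha>, \<beta>) \<in> r" if \<alpha>: "\<alpha> \<in> T - Tmin" and \<beta>: "\<beta> \<in> T - Tmin" for \<alpha> \<beta>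
  proof -
    obtain \<alpha>' where a: "\<alpha>' \<in> T" "\<alpha>' ` U = \<alpha> ` U" "\<alpha>' ` B \<noteq> \<alpha>' ` U"
      using ex_same_image_not_onto[of \<alpha>] \<alpha> by blast
    obtain \<beta>' where b: "\<beta>' \<in> T" "\<beta>' ` U = \<beta> ` U" "\<beta>' ` B \<noteq> \<beta>' ` U"
      using ex_same_image_not_onto[of \<beta>] \<beta> by blast
    have "(\<alpha>, \<alpha>') \<in> L_tilde T mult" "(\<beta>', \<beta>) \<in> L_tilde T mult"
      using \<alpha> \<beta> a(1,2) b(1,2) by (simp_all add: L_tilde_iff)
    then have "(\<alpha>, \<alpha>') \<in> r" "(\<beta>', \<beta>) \<in> r" using r(2) by auto
    moreover have "(\<alpha>', \<beta>') \<in> r"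
      using R_tilde_not_onto[OF a(1) b(1) a(3) b(3)] r(3) by blast
    ultimately show ?thesis using trans by blast
  qed
  ultimately show ?thesis by (auto simp: two_classes_def)
qed

lemma D_tilde_eq: "D_tilde T mult = two_classes"
  using two_classes_least equiv_two_classes L_tilde_sub R_tilde_sub
  unfolding D_tilde_def by blast

lemma Tmin_nonempty: "Tmin \<noteq> {}"
proof -
  obtain b where b: "b \<in> B" using B_nonempty by blast
  define M where "M = (if cl {} = {} then cl {b} else cl {})"
  have "{b} \<subseteq> U" using b B_sub by blast
  then have "min_sub M" "subalg M \<A>" "M \<subseteq> B"
    using min_sub_point[of b] min_sub_constants subalg_cl sub_gen_least[OF subalg_B] b
    by (auto simp: M_def)
  moreover from this have "M \<noteq> {}" by (simp add: min_sub_def)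
  ultimately obtain f where "f \<in> sg_idems T mult" "f ` U = M" using ex_idem_onto by blast
  then show ?thesis using \<open>min_sub M\<close> by (auto simp: Tmin_def sg_idems_def)
qed

text \<open>An idempotent onto \<open>B\<close> lies in the complement; this is where the assumption
  on the dimension of \<open>B\<close> enters.\<close>

lemma Tmin_proper: "T - Tmin \<noteq> {}"
proof -
  obtain f where "f \<in> sg_idems T mult" "f ` U = B"
    using ex_idem_onto[OF subalg_B B_nonempty] by blast
  then show ?thesis using B_not_min by (auto simp: Tmin_def sg_idems_def)
qed

text \<open>Agreement about membership in \<open>I\<close> is an equivalence relation containing
  L-tilde and R-tilde, so it contains \<open>two_classes\<close>.\<close>

lemma saturated_ideal_two_classes:
  assumes "sg_ideal T mult I" "saturated_by T (L_tilde T mult) I" "saturated_by T (R_tilde T mult) I"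
  shows "(a, b) \<in> two_classes \<Longrightarrow> a \<in> I \<longleftrightarrow> b \<in> I"
proof -
  define r where "r = {(a, b) \<in> T \<times> T. a \<in> I \<longleftrightarrow> b \<in> I}"
  have "equiv T r" by (auto simp: r_def equiv_def refl_on_def sym_def trans_def)
  moreover have "L_tilde T mult \<subseteq> r"
    using saturated_closed[OF equiv_L_tilde assms(2)] by (auto simp: r_def L_tilde_def)
  moreover have "R_tilde T mult \<subseteq> r"
    using saturated_closed[OF equiv_R_tilde assms(3)] by (auto simp: r_def R_tilde_def)
  ultimately show "(a, b) \<in> two_classes \<Longrightarrow> a \<in> I \<longleftrightarrow> b \<in> I"
    using two_classes_least[of r] by (auto simp: r_def)
qed

lemma Tmin_sub_saturated_ideal:
  assumes "sg_ideal T mult I" "saturated_by T (L_tilde T mult) I" "saturated_by T (R_tilde T mult) I"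
  shows "Tmin \<subseteq> I"
proof -
  obtain a where a: "a \<in> I" "a \<in> T" using assms(1) by (auto simp: sg_ideal_def)
  obtain t where t: "t \<in> Tmin" using Tmin_nonempty by blast
  \<comment> \<open>One common element of \<open>I\<close> and \<open>Tmin\<close> suffices, since
    \<open>I\<close> is a union of whole classes.\<close>
  have "mult t a \<in> I" "mult t a \<in> Tmin"
    using a t assms(1) Tmin_sub mult_Tmin_left by (auto simp: sg_ideal_def)
  then have "s \<in> I" if "s \<in> Tmin" for s
    using saturated_ideal_two_classes[OF assms, of "mult t a" s] that
    by (simp add: two_classes_def)
  then show ?thesis by blast
qed

text \<open>A saturated ideal contains \<open>Tmin\<close>, and with a single further element it
  contains the whole complement. The ideals \<open>J_tilde_ideal\<close> can then be read
  off.\<close>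

lemma saturated_ideal_iff:
  "sg_ideal T mult I \<and> saturated_by T (L_tilde T mult) I \<and> saturated_by T (R_tilde T mult) I
    \<longleftrightarrow> I = Tmin \<or> I = T" (is "?l \<longleftrightarrow> ?r")
proof
  assume l: ?l
  then have "Tmin \<subseteq> I" "I \<subseteq> T" using Tmin_sub_saturated_ideal by (auto simp: sg_ideal_def)
  moreover have "T \<subseteq> I" if "a \<in> I - Tmin" for a
  proof
    fix b assume "b \<in> T"
    then show "b \<in> I"
      using saturated_ideal_two_classes[of I a b] l that \<open>Tmin \<subseteq> I\<close> \<open>I \<subseteq> T\<close>
      by (auto simp: two_classes_def)
  qed
  ultimately show ?r by blast
next
  assume r: ?r
  have "sg_ideal T mult Tmin"
    using Tmin_nonempty Tmin_sub mult_Tmin_left mult_Tmin_right by (auto simp: sg_ideal_def)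
  moreover have "sg_ideal T mult T"
    using Tmin_nonempty Tmin_sub mult_in_T by (auto simp: sg_ideal_def T_iff)
  moreover have "saturated_by T (L_tilde T mult) I"
    using r Tmin_sub L_tilde_sub
    by (intro closed_saturated[OF equiv_L_tilde]) (auto simp: two_classes_def)
  moreover have "saturated_by T (R_tilde T mult) I"
    using r Tmin_sub R_tilde_sub
    by (intro closed_saturated[OF equiv_R_tilde]) (auto simp: two_classes_def)
  ultimately show ?l using r by blast
qed

lemma J_tilde_eq: "J_tilde T mult = two_classes"
proof -
  have J: "J_tilde_ideal T mult a = (if a \<in> Tmin then Tmin else T)" if "a \<in> T" for a
  proof -
    have "{I. sg_ideal T mult I \<and> a \<in> I \<and> saturated_by T (L_tilde T mult) I \<and>
        saturated_by T (R_tilde T mult) I} = (if a \<in> Tmin then {Tmin, T} else {T})"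
      using that saturated_ideal_iff by auto
    then show ?thesis using Tmin_sub by (auto simp: J_tilde_ideal_def)
  qed
  have "(a, b) \<in> J_tilde T mult \<longleftrightarrow> (a, b) \<in> two_classes" for a b
  proof (cases "a \<in> T \<and> b \<in> T")
    case True
    moreover have "Tmin \<noteq> T" using Tmin_proper by blast
    ultimately show ?thesis by (simp add: J_tilde_def two_classes_def J)
  next
    case False
    then show ?thesis using Tmin_sub by (auto simp: J_tilde_def two_classes_def)
  qed
  then show ?thesis by auto
qed

lemma quotient_two_classes: "T // two_classes = {Tmin, T - Tmin}"
proof -
  have "two_classes `` {a} = (if a \<in> Tmin then Tmin else T - Tmin)" if "a \<in> T" for a
    using that by (auto simp: two_classes_def)
  then have "T // two_classes = (\<lambda>a. if a \<in> Tmin then Tmin else T - Tmin) ` T"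
    by (auto simp: quotient_def)
  also have "\<dots> = {Tmin, T - Tmin}"
    using Tmin_nonempty Tmin_proper Tmin_sub by (auto simp: image_def)
  finally show ?thesis .
qed

section \<open>Translation to ranks\<close>

lemma Tmin_rank:
  assumes e: "e = (if cl {} \<noteq> {} then 0 else (1::nat))"
  shows "Tmin = {\<alpha> \<in> T. endo_rank \<A> \<alpha> <o |{..<e + 1}| }"
    and "Tmin = {\<alpha> \<in> T. endo_rank \<A> \<alpha> =o |{..<e}| }"
proof -
  have *: "(min_sub (\<alpha> ` U) \<longleftrightarrow> endo_rank \<A> \<alpha> <o |{..<e + 1}| ) \<and>
      (min_sub (\<alpha> ` U) \<longleftrightarrow> endo_rank \<A> \<alpha> =o |{..<e}| )" if \<alpha>: "\<alpha> \<in> T" for \<alpha>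
  proof -
    obtain X where X: "alg_basis \<A> (\<alpha> ` U) X" "endo_rank \<A> \<alpha> = |X|"
      using alg_dim_basis[OF subalg_image[OF \<alpha>]] by (auto simp: endo_rank_def)
    have "\<alpha> ` U \<subseteq> U" using T_in_U[OF \<alpha>] by blast
    from min_sub_basis_card[OF X(1) this image_nonempty e] show ?thesis by (simp add: X(2))
  qed
  show "Tmin = {\<alpha> \<in> T. endo_rank \<A> \<alpha> <o |{..<e + 1}| }"
    and "Tmin = {\<alpha> \<in> T. endo_rank \<A> \<alpha> =o |{..<e}| }"
    using * by (auto simp: Tmin_def)
qed

end

theorem proposition6p15:
  fixes \<A> :: "'a alg" and B :: "'a set" and e :: nat
    and T Te :: "('a \<Rightarrow> 'a) set"
  assumes "independence_algebra \<A>"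
    and "subalg B \<A>" and "B \<noteq> {}" and "B \<noteq> Univ \<A>"
    and "|{..<2::nat}| \<le>o alg_dim \<A> B \<or>
      (sub_gen \<A> {} \<noteq> {} \<and> alg_dim \<A> B =o |{..<1::nat}| )"
    and "T = endos_into \<A> B"
    and "e = (if sub_gen \<A> {} \<noteq> {} then 0 else 1)"
    and "Te = {\<alpha> \<in> T. endo_rank \<A> \<alpha> <o |{..<e + 1}| }"
  shows "Te = {\<alpha> \<in> T. endo_rank \<A> \<alpha> =o |{..<e}| } \<and>
    T // D_tilde T (endo_mult \<A>) = {Te, T - Te} \<and>
    T // J_tilde T (endo_mult \<A>) = {Te, T - Te}"
proof -
  interpret indep_algebra \<A> by unfold_locales (rule assms(1))
  obtain X where X: "alg_basis \<A> B X" "alg_dim \<A> B = |X|"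
    using alg_dim_basis[OF assms(2)] by blast
  \<comment> \<open>Both alternatives of the hypothesis give dimension at least
    \<open>e + 1\<close>: \<open>e\<close> is at most 1, and dimension 1 comes with constants, where
    \<open>e\<close> is 0.\<close>
  have "|{..<e + 1}| \<le>o |X|"
  proof (cases "|{..<2::nat}| \<le>o |X|")
    case True
    have "|{..<e + 1}| \<le>o |{..<2::nat}|" using assms(7) by (intro card_of_mono1) auto
    then show ?thesis using True ordLeq_transitive by blast
  next
    case False
    then have "e = 0" "|X| =o |{..<1::nat}|" using assms(5,7) X(2) by auto
    then show ?thesis using ordIso_symmetric ordIso_iff_ordLeq by auto
  qed
  then have "\<not> |X| <o |{..<e + 1}|" using not_ordLess_ordLeq by blast
  moreover have "B \<subseteq> Univ \<A>" using assms(2) by (simp add: subalg_def)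
  ultimately have "\<not> min_sub B"
    using min_sub_basis_card(1)[OF X(1) _ assms(3,7)] by simp
  then interpret restricted_range \<A> B
    using assms by unfold_locales auto
  have "Te = Tmin" using Tmin_rank(1)[OF assms(7)] assms(6,8) by simp
  then show ?thesis
    using Tmin_rank(2)[OF assms(7)] D_tilde_eq J_tilde_eq quotient_two_classes assms(6) by simp
qed

end
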